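(* Let $N\ge 2$ be an integer, $\alpha\in(0,1)$, $\lambda>0$ and $f\in L^2(\mathbb{T},\mu)$. Let $u=(v,a_2,\dots,a_{N+1})\in\mathcal{H}_\alpha(\mathbb{T})$ be the minimizer over $\mathcal{H}_\alpha(\mathbb{T})$ of $$\mathcal{J}(w)=\frac12\mathcal{E}_\alpha(w)+\frac{\lambda}{2}\|w\|_{L^2(\mathbb{T},\mu)}^2-\int_{\mathbb{T}}fw\,d\mu .$$ Then, for every $\varphi=(\psi,b_2,\dots,b_{N+1})\in\mathcal{H}_\alpha(\mathbb{T})$, $$\int_0^1\int_0^1\frac{(v(x)-v(y))(\psi(x)-\psi(y))}{|x-y|^{1+2\alpha}}\,dx\,dy+2\sum_{k=2}^{N+1}\int_0^1\frac{(a_k-v(x))(b_k-\psi(x))}{|k-x|^{1+2\alpha}}\,dx+\sum_{\substack{i,j=2\\ i\neq j}}^{N+1}\frac{(a_i-a_j)(b_i-b_j)}{|i-j|^{1+2\alpha}}+\lambda\int_{\mathbb{T}}u\varphi\,d\mu=\int_{\mathbb{T}}f\varphi\,d\mu .$$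
   Context: Let $D=\{2,3,\dots,N+1\}$ and $\mathbb{T}=[0,1]\cup D\subset\mathbb{R}$, with the positive finite Borel measure $\mu(A)=\int_{A\cap[0,1]}dx+\sum_{k=2}^{N+1}\delta_k(A)$, so that $\int_{\mathbb{T}} f\,d\mu=\int_0^1 f(x)\,dx+\sum_{k=2}^{N+1}f(k)$. A function $u:\mathbb{T}\to\mathbb{R}$ is written $u=(v,a_2,\dots,a_{N+1})$ with $v=u|_{[0,1]}$ and $a_k=u(k)$. The Gagliardo seminorm is $[v]_{H^\alpha(0,1)}^2=\int_0^1\int_0^1\frac{|v(x)-v(y)|^2}{|x-y|^{1+2\alpha}}\,dx\,dy$, and $H^\alpha(0,1)=\{v\in L^2(0,1):[v]_{H^\alpha(0,1)}<\infty\}$. The hybrid energy space is $\mathcal{H}_\alpha(\mathbb{T})=\{u=(v,a_2,\dots,a_{N+1}): v\in H^\alpha(0,1),\ a_k\in\mathbb{R}\}$ (functions identified when equal $\mu$-a.e.). The energy is $\mathcal{E}_\alpha(u)=\iint_{\mathbb{T}\times\mathbb{T}}\frac{|u(x)-u(y)|^2}{|x-y|^{1+2\alpha}}\,d\mu(x)\,d\mu(y)$, where the integrand is taken to be $0$ on the diagonal $x=y$. *)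

theory Defs
  imports "HOL-Analysis.Analysis"
begin

definition hybrid_domain :: "nat \<Rightarrow> real set" where
  "hybrid_domain N = {0..1} \<union> real ` {2..N+1}"

definition hybrid_measure :: "nat \<Rightarrow> real measure" where
  "hybrid_measure N =
     measure_of (hybrid_domain N) (sets (restrict_space borel (hybrid_domain N)))
       (\<lambda>A. emeasure lborel (A \<inter> {0..1}) + (\<Sum>k=2..N+1. indicator A (real k)))"

definition L2_space :: "'a measure \<Rightarrow> ('a \<Rightarrow> real) set" where
  "L2_space M = {f \<in> borel_measurable M. integrable M (\<lambda>x. (f x)\<^sup>2)}"

definition L2_norm :: "'a measure \<Rightarrow> ('a \<Rightarrow> real) \<Rightarrow> real" where
  "L2_norm M f = sqrt (\<integral>x. (f x)\<^sup>2 \<partial>M)"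

definition gagliardo_integrand :: "real \<Rightarrow> (real \<Rightarrow> real) \<Rightarrow> real \<Rightarrow> real \<Rightarrow> real" where
  "gagliardo_integrand \<alpha> u x y =
     (if x = y then 0 else \<bar>u x - u y\<bar>\<^sup>2 / \<bar>x - y\<bar> powr (1 + 2 * \<alpha>))"

definition gagliardo_seminorm_sq :: "real \<Rightarrow> (real \<Rightarrow> real) \<Rightarrow> ennreal" where
  "gagliardo_seminorm_sq \<alpha> v =
     (\<integral>\<^sup>+y\<in>{0..1}. (\<integral>\<^sup>+x\<in>{0..1}. ennreal (gagliardo_integrand \<alpha> v x y) \<partial>lborel) \<partial>lborel)"

definition frac_sobolev :: "real \<Rightarrow> (real \<Rightarrow> real) set" where
  "frac_sobolev \<alpha> =
     {v \<in> L2_space (restrict_space lborel {0..1}). gagliardo_seminorm_sq \<alpha> v < \<infinity>}"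

text \<open>
  A function on the hybrid domain is represented by a total function \<open>u\<close> on the reals, with
  \<open>v\<close> its restriction to the unit interval and \<open>a\<^sub>k = u (real k)\<close>; its values off the domain play
  no role. The numbers \<open>a\<^sub>k\<close> are unconstrained, which is why \<open>N\<close> does not occur in
  \<open>hybrid_space\<close>. Functions equal almost everywhere are not identified; the energy,
  the functional and all integrals below are invariant under such changes.
\<close>

definition hybrid_space :: "real \<Rightarrow> (real \<Rightarrow> real) set" where
  "hybrid_space \<alpha> = {u. restrict u {0..1} \<in> frac_sobolev \<alpha>}"

definition hybrid_energy :: "nat \<Rightarrow> real \<Rightarrow> (real \<Rightarrow> real) \<Rightarrow> ennreal" where
  "hybrid_energy N \<alpha> u =
     (\<integral>\<^sup>+(x, y). ennreal (gagliardo_integrand \<alpha> u x y)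
        \<partial>(hybrid_measure N \<Otimes>\<^sub>M hybrid_measure N))"

text \<open>
  The energy is finite on \<open>hybrid_space \<alpha>\<close> (distinct components of the domain are at distance at
  least 1), so \<open>enn2real\<close> loses nothing there.
\<close>

definition hybrid_functional ::
  "nat \<Rightarrow> real \<Rightarrow> real \<Rightarrow> (real \<Rightarrow> real) \<Rightarrow> (real \<Rightarrow> real) \<Rightarrow> real" where
  "hybrid_functional N \<alpha> lam f w =
     1 / 2 * enn2real (hybrid_energy N \<alpha> w)
     + lam / 2 * (L2_norm (hybrid_measure N) w)\<^sup>2
     - (\<integral>x. f x * w x \<partial>hybrid_measure N)"

lemma hybrid_domain_borel: "hybrid_domain N \<in> sets borel"
proof -
  have "closed (hybrid_domain N)"
    unfolding hybrid_domain_def by (intro closed_Un closed_atLeastAtMost) (auto intro: finite_imp_closed)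
  then show ?thesis by (rule borel_closed)
qed

lemma restrict_hybrid_domain_subset:
  "sets (restrict_space borel (hybrid_domain N)) \<subseteq> Pow (hybrid_domain N)"
  using sets.space_closed[of "restrict_space borel (hybrid_domain N)"]
  by (simp add: space_restrict_space)

lemma space_hybrid_measure [simp]: "space (hybrid_measure N) = hybrid_domain N"
  unfolding hybrid_measure_def by (rule space_measure_of[OF restrict_hybrid_domain_subset])

lemma sets_hybrid_measure:
  "sets (hybrid_measure N) = sets (restrict_space borel (hybrid_domain N))"
proof -
  have "sigma_sets (hybrid_domain N) (sets (restrict_space borel (hybrid_domain N))) =
      sets (restrict_space borel (hybrid_domain N))"
    using sets.sigma_sets_eq[of "restrict_space borel (hybrid_domain N)"]
    by (simp add: space_restrict_space)
  then show ?thesis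
    unfolding hybrid_measure_def by (simp only: sets_measure_of[OF restrict_hybrid_domain_subset])
qed

text \<open>The set function used in \<open>hybrid_measure\<close> is a measure, so \<open>measure_of\<close> is not degenerate.\<close>

lemma emeasure_hybrid_measure:
  assumes "A \<in> sets borel" "A \<subseteq> hybrid_domain N"
  shows "emeasure (hybrid_measure N) A =
    emeasure lborel (A \<inter> {0..1}) + (\<Sum>k=2..N+1. indicator A (real k))"
proof (rule emeasure_measure_of[OF hybrid_measure_def])
  let ?S = "sets (restrict_space borel (hybrid_domain N))"
  let ?m = "\<lambda>A. emeasure lborel (A \<inter> {0..1}) + (\<Sum>k=2..N+1. indicator A (real k)) :: ennreal"
  have borel: "B \<in> sets borel" if "B \<in> ?S" for B
    using that hybrid_domain_borel sets_restrict_space_iff[of "hybrid_domain N" borel B] by simp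
  show "?S \<subseteq> Pow (hybrid_domain N)" by (rule restrict_hybrid_domain_subset)
  show "A \<in> sets (hybrid_measure N)"
    using assms hybrid_domain_borel
    by (simp add: sets_hybrid_measure sets_restrict_space_iff)
  show "positive (sets (hybrid_measure N)) ?m"
    by (simp add: positive_def)
  show "countably_additive (sets (hybrid_measure N)) ?m"
  proof (rule countably_additiveI)
    fix B :: "nat \<Rightarrow> real set"
    assume B: "range B \<subseteq> sets (hybrid_measure N)" "disjoint_family B"
    have "(\<Sum>i. ?m (B i)) =
        (\<Sum>i. emeasure lborel (B i \<inter> {0..1})) + (\<Sum>i. \<Sum>k=2..N+1. indicator (B i) (real k))"
      by (rule suminf_add[symmetric]) auto
    also have "(\<Sum>i. emeasure lborel (B i \<inter> {0..1})) = emeasure lborel (\<Union>i. B i \<inter> {0..1})"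
      using B borel by (intro suminf_emeasure)
        (auto simp: sets_hybrid_measure disjoint_family_on_def intro!: sets.Int)
    also have "(\<Union>i. B i \<inter> {0..1}) = (\<Union>i. B i) \<inter> {0..1}" by auto
    also have "(\<Sum>i. \<Sum>k=2..N+1. indicator (B i) (real k) :: ennreal) =
        (\<Sum>k=2..N+1. \<Sum>i. indicator (B i) (real k))"
      by (rule suminf_sum) auto
    also have "\<dots> = (\<Sum>k=2..N+1. indicator (\<Union>i. B i) (real k))"
      using suminf_indicator[OF B(2)] by simp
    finally show "(\<Sum>i. ?m (B i)) = ?m (\<Union>i. B i)" .
  qed
qed

end

theory Submission
  imports Defs
begin

text \<open>
  Along every line \<open>u + t \<phi>\<close> the functional is a quadratic polynomial in \<open>t\<close>, because the kernel
  is at most 1 between distinct components of the domain and therefore the energy is a finite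
  quadratic form on \<open>hybrid_space \<alpha>\<close>. Minimality at \<open>t = 0\<close> forces its linear coefficient to
  vanish. Expanding the polarised energy over the components \<open>[0,1], {2}, \<dots>, {N+1}\<close> of each
  factor gives the local, mixed and discrete terms; the factor 2 comes from the symmetry of the form.
\<close>

section \<open>Elementary facts on quadratic polynomials and square-integrable functions\<close>

lemma quadratic_min_at_0_imp_linear_coeff_0:
  fixes b c :: real
  assumes "\<And>t. 0 \<le> b * t + c * t\<^sup>2"
  shows "b = 0"
proof (rule ccontr)
  assume "b \<noteq> 0"
  \<comment> \<open>Any \<open>d\<close> above both 0 and \<open>c\<close> serves, whatever the sign
    of \<open>c\<close>: the polynomial at \<open>- b / d\<close> equals
    \<open>b\<^sup>2 / d\<^sup>2 * (c - d)\<close>, which is negative. Adding 1 to the modulus makes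
    both inequalities strict.\<close>
  define d where "d = \<bar>c\<bar> + 1"
  have d: "d > 0" "c < d" by (auto simp: d_def)
  have "b * (- b / d) + c * (- b / d)\<^sup>2 = b\<^sup>2 / d\<^sup>2 * (c - d)"
    using d by (simp add: field_simps power2_eq_square)
  moreover have "b\<^sup>2 / d\<^sup>2 * (c - d) < 0"
    using d \<open>b \<noteq> 0\<close> by (intro mult_pos_neg) auto
  ultimately show False using assms[of "- b / d"] by simp
qed

text \<open>Domination by the sum of the two squares, a weak form of Young's inequality. It serves
  both for L2 products on the hybrid domain and for the polarised energy density on its
  square.\<close>

lemma integrable_mult_of_squares:
  fixes g h :: "'a \<Rightarrow> real"
  assumes [measurable]: "g \<in> borel_measurable M" "h \<in> borel_measurable M"
    and g: "integrable M (\<lambda>x. (g x)\<^sup>2)" and h: "integrable M (\<lambda>x. (h x)\<^sup>2)"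
  shows "integrable M (\<lambda>x. g x * h x)"
proof (rule Bochner_Integration.integrable_bound)
  show "integrable M (\<lambda>x. (g x)\<^sup>2 + (h x)\<^sup>2)" using g h by simp
  have "\<bar>a * b\<bar> \<le> a\<^sup>2 + b\<^sup>2" for a b :: real
  proof -
    have "2 * (\<bar>a\<bar> * \<bar>b\<bar>) \<le> a\<^sup>2 + b\<^sup>2"
      using zero_le_power2[of "\<bar>a\<bar> - \<bar>b\<bar>"] by (simp add: power2_diff)
    moreover have "0 \<le> \<bar>a\<bar> * \<bar>b\<bar>" by simp
    ultimately show ?thesis unfolding abs_mult by linarith
  qed
  then show "AE x in M. norm (g x * h x) \<le> norm ((g x)\<^sup>2 + (h x)\<^sup>2)" by simp
qed simp

subsection \<open>Integration over the hybrid domain\<close>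

lemma unit_interval_in_sets_hybrid [measurable]: "{0..1} \<in> sets (hybrid_measure N)"
  using hybrid_domain_borel by (auto simp: sets_hybrid_measure sets_restrict_space_iff hybrid_domain_def)

lemma singleton_in_sets_hybrid:
  "k \<in> {2..N+1} \<Longrightarrow> {real k} \<in> sets (hybrid_measure N)"
  using hybrid_domain_borel by (auto simp: sets_hybrid_measure sets_restrict_space_iff hybrid_domain_def)

lemma emeasure_hybrid_singleton:
  assumes "k \<in> {2..N+1}"
  shows "emeasure (hybrid_measure N) {real k} = 1"
proof -
  have "emeasure (hybrid_measure N) {real k} =
      emeasure lborel ({real k} \<inter> {0..1}) + (\<Sum>j=2..N+1. indicator {real k} (real j))"
    using assms by (intro emeasure_hybrid_measure) (auto simp: hybrid_domain_def)
  also have "{real k} \<inter> {0..1} = {}" using assms by auto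
  also have "(\<Sum>j=2..N+1. indicator {real k} (real j)) = (\<Sum>j=2..N+1. if j = k then 1 else 0 :: ennreal)"
    by (intro sum.cong) (auto simp: indicator_def)
  finally show ?thesis using assms by (simp add: sum.delta)
qed

lemma finite_measure_hybrid: "finite_measure (hybrid_measure N)"
proof
  show "emeasure (hybrid_measure N) (space (hybrid_measure N)) \<noteq> \<infinity>"
    using hybrid_domain_borel[of N] unfolding space_hybrid_measure
    by (subst emeasure_hybrid_measure) (auto simp: hybrid_domain_def indicator_def Int_absorb1)
qed

lemma pair_sigma_finite_hybrid: "pair_sigma_finite (hybrid_measure N) (hybrid_measure N)"
  using finite_measure.axioms(1)[OF finite_measure_hybrid[of N]]
  by (simp add: pair_sigma_finite_def)

text \<open>The atoms start at 2, so none of them charges a subset of [0,1]. This identity carries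
  measurability and integrals between Lebesgue measure on the interval and the hybrid
  measure.\<close>

lemma restrict_space_hybrid_unit_interval:
  "restrict_space (hybrid_measure N) {0..1} = restrict_space lborel {0..1}"
proof (rule measure_eqI)
  show "sets (restrict_space (hybrid_measure N) {0..1}) = sets (restrict_space lborel {0..1})"
  proof -
    have "hybrid_domain N \<inter> {0..1} = {0..1}" by (auto simp: hybrid_domain_def)
    moreover have "sets (restrict_space (hybrid_measure N) {0..1}) =
        sets (restrict_space (restrict_space borel (hybrid_domain N)) {0..1})"
      by (rule sets_restrict_space_cong) (rule sets_hybrid_measure)
    moreover have "sets (restrict_space borel {0..1}) = sets (restrict_space lborel {0..1::real})"
      by (rule sets_restrict_space_cong) simp
    ultimately show ?thesis by (simp add: sets_restrict_restrict_space)
  qed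
  fix A assume "A \<in> sets (restrict_space (hybrid_measure N) {0..1})"
  then have A: "A \<subseteq> {0..1}" "A \<in> sets (hybrid_measure N)"
    using sets_restrict_space_iff[of "{0..1}" "hybrid_measure N" A] unit_interval_in_sets_hybrid[of N]
    by (simp_all add: hybrid_domain_def Int_absorb1)
  then have "A \<in> sets borel" "A \<subseteq> hybrid_domain N"
    using hybrid_domain_borel by (auto simp: sets_hybrid_measure sets_restrict_space_iff)
  moreover have "(\<Sum>k=2..N+1. indicator A (real k)) = (0::ennreal)"
    using A by (intro sum.neutral) (auto simp: indicator_def)
  moreover have "A \<inter> {0..1} = A" using A by auto
  ultimately show "emeasure (restrict_space (hybrid_measure N) {0..1}) A
      = emeasure (restrict_space lborel {0..1}) A"
    using A emeasure_hybrid_measure[of A N] unit_interval_in_sets_hybrid[of N]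
    by (simp add: emeasure_restrict_space hybrid_domain_def Int_absorb1 del: sum.cl_ivl_Suc)
qed

text \<open>The sigma-algebra is the trace of the Borel sets. Declared for the measurability prover,
  which needs it for the coordinates \<open>x\<close> and \<open>y\<close> in the kernel.\<close>

lemma measurable_ident_hybrid [measurable]: "(\<lambda>x. x) \<in> hybrid_measure N \<rightarrow>\<^sub>M borel"
proof -
  have "(\<lambda>x. x) \<in> restrict_space borel (hybrid_domain N) \<rightarrow>\<^sub>M borel"
    by (rule measurable_restrict_space1) simp
  then show ?thesis
    by (simp cong: measurable_cong_sets add: measurable_cong_sets[OF sets_hybrid_measure refl])
qed

text \<open>The domain is a finite union of measurable pieces, and on a singleton every function is
  constant, so only the piece [0,1] imposes a condition.\<close>

lemma borel_measurable_hybrid_iff: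
  fixes w :: "real \<Rightarrow> real"
  shows "w \<in> borel_measurable (hybrid_measure N) \<longleftrightarrow>
    w \<in> borel_measurable (restrict_space lborel {0..1})"
proof
  assume "w \<in> borel_measurable (hybrid_measure N)"
  then show "w \<in> borel_measurable (restrict_space lborel {0..1})"
    unfolding restrict_space_hybrid_unit_interval[of N, symmetric] by (rule measurable_restrict_space1)
next
  assume w: "w \<in> borel_measurable (restrict_space lborel {0..1})"
  show "w \<in> borel_measurable (hybrid_measure N)"
  proof (rule measurable_piecewise_restrict)
    let ?C = "insert {0..1} ((\<lambda>k. {real k}) ` {2..N+1})"
    show "countable ?C" by simp
    show "\<Omega> \<inter> space (hybrid_measure N) \<in> sets (hybrid_measure N)" if "\<Omega> \<in> ?C" for \<Omega>
      using that unit_interval_in_sets_hybrid[of N] singleton_in_sets_hybrid[of _ N]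
      by (intro sets.Int sets.top) auto
    show "space (hybrid_measure N) \<subseteq> \<Union> ?C" by (auto simp: hybrid_domain_def)
    show "w \<in> borel_measurable (restrict_space (hybrid_measure N) \<Omega>)" if "\<Omega> \<in> ?C" for \<Omega>
    proof (cases "\<Omega> = {0..1}")
      case True
      then show ?thesis using w by (simp add: restrict_space_hybrid_unit_interval)
    next
      case False
      then obtain k where \<Omega>: "\<Omega> = {real k}" using \<open>\<Omega> \<in> ?C\<close> by auto
      have "(\<lambda>_. w (real k)) \<in> borel_measurable (restrict_space (hybrid_measure N) \<Omega>)" by simp
      then show ?thesis
        by (rule measurable_cong[THEN iffD1, rotated]) (auto simp: \<Omega> space_restrict_space)
    qed
  qed
qed

text \<open>The pieces are disjoint, so exactly one term survives. In the atomic terms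
  \<open>w\<close> is evaluated at the constant \<open>real k\<close>, which makes them scalar
  multiples of indicators. The general semiring covers real and extended nonnegative values at
  once.\<close>

lemma hybrid_indicator_split:
  fixes w :: "real \<Rightarrow> 'a::{comm_semiring_1}"
  assumes "x \<in> hybrid_domain N"
  shows "w x = indicator {0..1} x * w x + (\<Sum>k=2..N+1. indicator {real k} x * w (real k))"
proof (cases "x \<in> {0..1}")
  case True
  then have "(\<Sum>k=2..N+1. indicator {real k} x * w (real k)) = 0"
    by (intro sum.neutral) (auto simp: indicator_def)
  then show ?thesis using True by simp
next
  case False
  then obtain j where j: "x = real j" "j \<in> {2..N+1}" using assms by (auto simp: hybrid_domain_def)
  have "(\<Sum>k=2..N+1. indicator {real k} x * w (real k)) = (\<Sum>k=2..N+1. if k = j then w x else 0)"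
    using j by (intro sum.cong) (auto simp: indicator_def)
  then show ?thesis using False j by (simp add: sum.delta)
qed

text \<open>By the indicator splitting, \<open>w\<close> differs from its part on [0,1] by finitely
  many multiples of indicators of atoms, each of mass 1, and these are always integrable.\<close>

lemma integrable_hybrid_iff:
  fixes w :: "real \<Rightarrow> real"
  shows "integrable (hybrid_measure N) w \<longleftrightarrow> integrable (restrict_space lborel {0..1}) w"
proof -
  let ?M = "hybrid_measure N"
  have atom: "integrable ?M (\<lambda>x. indicator {real k} x * w (real k))" if "k \<in> {2..N+1}" for k
    using that singleton_in_sets_hybrid[OF that] emeasure_hybrid_singleton[OF that]
    by (intro integrable_mult_left integrable_real_indicator) auto
  have atoms: "integrable ?M (\<lambda>x. \<Sum>k=2..N+1. indicator {real k} x * w (real k))"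
    by (intro Bochner_Integration.integrable_sum atom)
  have "integrable ?M w \<longleftrightarrow> integrable ?M (\<lambda>x. indicator {0..1} x * w x)"
  proof
    assume "integrable ?M w"
    then show "integrable ?M (\<lambda>x. indicator {0..1} x * w x)"
      using integrable_real_mult_indicator[OF unit_interval_in_sets_hybrid] by (simp add: mult.commute)
  next
    assume "integrable ?M (\<lambda>x. indicator {0..1} x * w x)"
    from Bochner_Integration.integrable_add[OF this atoms] show "integrable ?M w"
      by (rule Bochner_Integration.integrable_cong[THEN iffD1, OF refl, rotated])
        (use hybrid_indicator_split[of _ N w] in simp)
  qed
  also have "\<dots> \<longleftrightarrow> integrable (restrict_space ?M {0..1}) w"
    by (subst integrable_restrict_space) (auto simp: hybrid_domain_def Int_absorb1 set_integrable_def)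
  finally show ?thesis by (simp add: restrict_space_hybrid_unit_interval)
qed

lemma integral_hybrid_unit_interval:
  fixes w :: "real \<Rightarrow> real"
  shows "(\<integral>x. indicator {0..1} x * w x \<partial>hybrid_measure N) = (LINT x:{0..1}|lborel. w x)"
proof -
  have "(\<integral>x. indicator {0..1} x * w x \<partial>hybrid_measure N)
      = integral\<^sup>L (restrict_space (hybrid_measure N) {0..1}) w"
    by (subst integral_restrict_space)
      (auto simp: hybrid_domain_def Int_absorb1 set_lebesgue_integral_def)
  also have "\<dots> = (LINT x:{0..1}|lborel. w x)"
    unfolding restrict_space_hybrid_unit_interval
    by (subst integral_restrict_space) (auto simp: set_lebesgue_integral_def)
  finally show ?thesis .
qed

lemma integral_hybrid:
  fixes w :: "real \<Rightarrow> real"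
  assumes "integrable (hybrid_measure N) w"
  shows "(\<integral>x. w x \<partial>hybrid_measure N) = (LINT x:{0..1}|lborel. w x) + (\<Sum>k=2..N+1. w (real k))"
proof -
  let ?M = "hybrid_measure N"
  have atom: "has_bochner_integral ?M (\<lambda>x. indicator {real k} x * w (real k)) (w (real k))"
    if "k \<in> {2..N+1}" for k
    using that singleton_in_sets_hybrid[OF that] emeasure_hybrid_singleton[OF that]
      has_bochner_integral_mult_left[OF has_bochner_integral_real_indicator[of "{real k}" ?M], of "w (real k)"]
    by (simp add: measure_def)
  have "(\<integral>x. w x \<partial>?M) =
      (\<integral>x. indicator {0..1} x * w x + (\<Sum>k=2..N+1. indicator {real k} x * w (real k)) \<partial>?M)"
    using hybrid_indicator_split[of _ N w] by (intro Bochner_Integration.integral_cong) auto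
  also have "\<dots> = (\<integral>x. indicator {0..1} x * w x \<partial>?M)
      + (\<integral>x. (\<Sum>k=2..N+1. indicator {real k} x * w (real k)) \<partial>?M)"
    using integrable_real_mult_indicator[OF unit_interval_in_sets_hybrid assms] atom
    by (intro Bochner_Integration.integral_add Bochner_Integration.integrable_sum)
      (auto simp: mult.commute has_bochner_integral_iff)
  also have "(\<integral>x. (\<Sum>k=2..N+1. indicator {real k} x * w (real k)) \<partial>?M) = (\<Sum>k=2..N+1. w (real k))"
    by (rule has_bochner_integral_integral_eq) (rule has_bochner_integral_sum[OF atom])
  finally show ?thesis by (simp add: integral_hybrid_unit_interval)
qed

lemma nn_integral_hybrid:
  fixes w :: "real \<Rightarrow> ennreal"
  assumes [measurable]: "w \<in> borel_measurable (hybrid_measure N)"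
  shows "(\<integral>\<^sup>+x. w x \<partial>hybrid_measure N) = (\<integral>\<^sup>+x\<in>{0..1}. w x \<partial>lborel) + (\<Sum>k=2..N+1. w (real k))"
proof -
  let ?M = "hybrid_measure N"
  have atom: "(\<integral>\<^sup>+x. indicator {real k} x * w (real k) \<partial>?M) = w (real k)" if "k \<in> {2..N+1}" for k
    using that singleton_in_sets_hybrid[OF that] emeasure_hybrid_singleton[OF that]
    by (simp add: nn_integral_multc)
  have [measurable]: "(\<lambda>x. indicator {real k} x * w (real k)) \<in> borel_measurable ?M"
    if "k \<in> {2..N+1}" for k
    using singleton_in_sets_hybrid[OF that] by measurable
  have "(\<integral>\<^sup>+x. w x \<partial>?M) =
      (\<integral>\<^sup>+x. indicator {0..1} x * w x + (\<Sum>k=2..N+1. indicator {real k} x * w (real k)) \<partial>?M)"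
    using hybrid_indicator_split[of _ N w] by (intro nn_integral_cong) auto
  also have "\<dots> = (\<integral>\<^sup>+x. indicator {0..1} x * w x \<partial>?M)
      + (\<integral>\<^sup>+x. (\<Sum>k=2..N+1. indicator {real k} x * w (real k)) \<partial>?M)"
    by (intro nn_integral_add borel_measurable_sum) auto
  also have "(\<integral>\<^sup>+x. (\<Sum>k=2..N+1. indicator {real k} x * w (real k)) \<partial>?M)
      = (\<Sum>k=2..N+1. \<integral>\<^sup>+x. indicator {real k} x * w (real k) \<partial>?M)"
    by (rule nn_integral_sum) auto
  also have "\<dots> = (\<Sum>k=2..N+1. w (real k))"
    using atom by (intro sum.cong) auto
  also have "(\<integral>\<^sup>+x. indicator {0..1} x * w x \<partial>?M) = (\<integral>\<^sup>+x. w x \<partial>restrict_space ?M {0..1})"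
    by (subst nn_integral_restrict_space) (auto simp: hybrid_domain_def Int_absorb1 mult.commute)
  also have "\<dots> = (\<integral>\<^sup>+x\<in>{0..1}. w x \<partial>lborel)"
    unfolding restrict_space_hybrid_unit_interval
    by (subst nn_integral_restrict_space) (auto simp: mult.commute)
  finally show ?thesis .
qed

text \<open>Atoms have mass 1 and hence lie in no null set. This turns the almost-everywhere
  statements of Fubini's theorem into statements at each atom.\<close>

lemma AE_hybrid_atom:
  assumes "AE x in hybrid_measure N. P x" "k \<in> {2..N+1}"
  shows "P (real k)"
proof (rule ccontr)
  assume "\<not> P (real k)"
  obtain A where A: "A \<in> sets (hybrid_measure N)" "emeasure (hybrid_measure N) A = 0"
    "{x \<in> space (hybrid_measure N). \<not> P x} \<subseteq> A"
    using assms(1) by (auto elim: AE_E)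
  have "{real k} \<subseteq> A" using A(3) \<open>\<not> P (real k)\<close> assms(2) by (auto simp: hybrid_domain_def)
  then have "emeasure (hybrid_measure N) {real k} \<le> 0" using A emeasure_mono by metis
  then show False using emeasure_hybrid_singleton[OF assms(2)] by simp
qed

section \<open>Double integrals of symmetric functions over the hybrid domain\<close>

text \<open>Fubini's theorem followed by the one-variable decomposition in each variable. The blocks
  [0,1] x {k} and {k} x [0,1] contribute equally by symmetry, whence the factor 2.\<close>

lemma integral_hybrid_pair:
  fixes g :: "real \<Rightarrow> real \<Rightarrow> real"
  assumes g: "integrable (hybrid_measure N \<Otimes>\<^sub>M hybrid_measure N) (\<lambda>(x, y). g x y)"
    and sym: "\<And>x y. g x y = g y x"
  shows "(\<integral>(x, y). g x y \<partial>(hybrid_measure N \<Otimes>\<^sub>M hybrid_measure N)) =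
      (LINT y:{0..1}|lborel. (LINT x:{0..1}|lborel. g x y))
      + 2 * (\<Sum>k=2..N+1. LINT x:{0..1}|lborel. g (real k) x)
      + (\<Sum>k=2..N+1. \<Sum>j=2..N+1. g (real k) (real j))"
proof -
  let ?M = "hybrid_measure N"
  interpret pair_sigma_finite ?M ?M by (rule pair_sigma_finite_hybrid)
  define I where "I y = (LINT x:{0..1}|lborel. g x y)" for y
  \<comment> \<open>Cutting off the first variable makes \<open>I\<close> a partial integral of an
    integrable function, so that the one-variable decomposition can be applied to \<open>I\<close>
    as well.\<close>
  have g01: "integrable (?M \<Otimes>\<^sub>M ?M) (\<lambda>(x, y). indicator {0..1} x * g x y)"
  proof -
    have "integrable (?M \<Otimes>\<^sub>M ?M) (\<lambda>p. (case p of (x, y) \<Rightarrow> g x y) * indicator ({0..1} \<times> space ?M) p)"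
      by (intro integrable_real_mult_indicator g pair_measureI sets.top unit_interval_in_sets_hybrid)
    then show ?thesis
      by (rule Bochner_Integration.integrable_cong[THEN iffD1, OF refl, rotated])
        (auto simp: space_pair_measure indicator_def)
  qed
  have I: "integrable ?M I"
    using integrable_snd[OF g01] by (simp add: I_def[abs_def] integral_hybrid_unit_interval)
  have ae: "AE y in ?M. integrable ?M (\<lambda>x. g x y)"
    using AE_integrable_snd[OF g] by simp
  \<comment> \<open>Fubini gives integrable sections for almost every \<open>y\<close>, hence at
    every atom; symmetry then moves the atom into the first argument.\<close>
  have atom: "integrable ?M (\<lambda>x. g (real k) x)" if "k \<in> {2..N+1}" for k
    using AE_hybrid_atom[OF ae that] by (simp add: sym)
  have sums: "integrable ?M (\<lambda>y. \<Sum>k=2..N+1. g (real k) y)"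
    by (intro Bochner_Integration.integrable_sum atom)
  have "(\<integral>(x, y). g x y \<partial>(?M \<Otimes>\<^sub>M ?M)) = (\<integral>y. (\<integral>x. g x y \<partial>?M) \<partial>?M)"
    using integral_snd[OF g] by simp
  also have "\<dots> = (\<integral>y. I y + (\<Sum>k=2..N+1. g (real k) y) \<partial>?M)"
  proof (rule integral_cong_AE)
    show "(\<lambda>y. \<integral>x. g x y \<partial>?M) \<in> borel_measurable ?M" using integrable_snd[OF g] by auto
    show "(\<lambda>y. I y + (\<Sum>k=2..N+1. g (real k) y)) \<in> borel_measurable ?M"
      using I sums by (intro borel_measurable_add) auto
    show "AE y in ?M. (\<integral>x. g x y \<partial>?M) = I y + (\<Sum>k=2..N+1. g (real k) y)"
      using ae by eventually_elim (simp add: I_def integral_hybrid)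
  qed
  also have "\<dots> = (\<integral>y. I y \<partial>?M) + (\<Sum>k=2..N+1. \<integral>y. g (real k) y \<partial>?M)"
    using I sums atom by (simp add: Bochner_Integration.integral_sum del: sum.cl_ivl_Suc)
  also have "(\<integral>y. I y \<partial>?M) = (LINT y:{0..1}|lborel. I y) + (\<Sum>k=2..N+1. I (real k))"
    by (rule integral_hybrid[OF I])
  also have "(\<Sum>k=2..N+1. \<integral>y. g (real k) y \<partial>?M) =
      (\<Sum>k=2..N+1. LINT x:{0..1}|lborel. g (real k) x) + (\<Sum>k=2..N+1. \<Sum>j=2..N+1. g (real k) (real j))"
    using atom by (simp add: integral_hybrid sum.distrib del: sum.cl_ivl_Suc)
  also have "(\<Sum>k=2..N+1. I (real k)) = (\<Sum>k=2..N+1. LINT x:{0..1}|lborel. g (real k) x)"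
    unfolding I_def by (simp only: sym[of _ "real _"])
  finally show ?thesis by (simp add: I_def)
qed

subsection \<open>The energy as a quadratic form\<close>

text \<open>No case distinction on the diagonal is needed: there the numerator vanishes.\<close>

definition gagliardo_form :: "real \<Rightarrow> (real \<Rightarrow> real) \<Rightarrow> (real \<Rightarrow> real) \<Rightarrow> real \<Rightarrow> real \<Rightarrow> real" where
  "gagliardo_form \<alpha> v w x y = (v x - v y) * (w x - w y) / \<bar>x - y\<bar> powr (1 + 2 * \<alpha>)"

lemma gagliardo_integrand_eq_form: "gagliardo_integrand \<alpha> w x y = gagliardo_form \<alpha> w w x y"
  by (simp add: gagliardo_integrand_def gagliardo_form_def power2_eq_square)

lemma gagliardo_form_nonneg: "0 \<le> gagliardo_form \<alpha> w w x y"
  by (simp add: gagliardo_form_def)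

lemma gagliardo_form_sym: "gagliardo_form \<alpha> v w x y = gagliardo_form \<alpha> v w y x"
  by (simp add: gagliardo_form_def abs_minus_commute algebra_simps)

text \<open>The numerator is a product of two differences, each affine in \<open>t\<close>; the two
  cross terms coincide and give the coefficient \<open>2 * t\<close>.\<close>

lemma gagliardo_form_add_scaled:
  "gagliardo_form \<alpha> (\<lambda>x. v x + t * w x) (\<lambda>x. v x + t * w x) x y =
    gagliardo_form \<alpha> v v x y + 2 * t * gagliardo_form \<alpha> v w x y + t\<^sup>2 * gagliardo_form \<alpha> w w x y"
  unfolding gagliardo_form_def
  by (simp add: add_divide_distrib[symmetric] power2_eq_square) (simp add: algebra_simps)

lemma measurable_gagliardo_form [measurable]:
  assumes [measurable]: "v \<in> borel_measurable (hybrid_measure N)" "w \<in> borel_measurable (hybrid_measure N)"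
  shows "(\<lambda>(x, y). gagliardo_form \<alpha> v w x y) \<in> borel_measurable (hybrid_measure N \<Otimes>\<^sub>M hybrid_measure N)"
  unfolding gagliardo_form_def by measurable

text \<open>The Tonelli counterpart of \<open>integral_hybrid_pair\<close>, available before
  integrability is known and therefore suited to deciding when the energy is finite.\<close>

lemma nn_integral_hybrid_pair:
  fixes G :: "real \<Rightarrow> real \<Rightarrow> ennreal"
  assumes G: "(\<lambda>(x, y). G x y) \<in> borel_measurable (hybrid_measure N \<Otimes>\<^sub>M hybrid_measure N)"
    and sym: "\<And>x y. G x y = G y x"
  shows "(\<integral>\<^sup>+(x, y). G x y \<partial>(hybrid_measure N \<Otimes>\<^sub>M hybrid_measure N)) =
      (\<integral>\<^sup>+y\<in>{0..1}. (\<integral>\<^sup>+x\<in>{0..1}. G x y \<partial>lborel) \<partial>lborel)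
      + (\<Sum>k=2..N+1. \<integral>\<^sup>+x\<in>{0..1}. G (real k) x \<partial>lborel)
      + (\<Sum>k=2..N+1. (\<integral>\<^sup>+x\<in>{0..1}. G (real k) x \<partial>lborel) + (\<Sum>j=2..N+1. G (real k) (real j)))"
proof -
  let ?M = "hybrid_measure N"
  interpret pair_sigma_finite ?M ?M by (rule pair_sigma_finite_hybrid)
  define I where "I y = (\<integral>\<^sup>+x\<in>{0..1}. G x y \<partial>lborel)" for y
  have sec: "G x \<in> borel_measurable ?M" if "x \<in> space ?M" for x
    using measurable_compose[OF measurable_Pair1'[OF that] G] by simp
  have sec': "(\<lambda>x. G x y) \<in> borel_measurable ?M" if "y \<in> space ?M" for y
    using sec[OF that] by (simp add: sym[of _ y])
  have atom: "G (real k) \<in> borel_measurable ?M" if "k \<in> {2..N+1}" for k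
    using that by (intro sec) (auto simp: hybrid_domain_def)
  have I: "I \<in> borel_measurable ?M"
  proof -
    \<comment> \<open>Symmetry permits the exchanged order of the arguments, so that
      \<open>I\<close> arises by integrating out the second factor.\<close>
    have "(\<lambda>(y, x). G x y * indicator {0..1} x) \<in> borel_measurable (?M \<Otimes>\<^sub>M ?M)"
      using G by (simp add: sym case_prod_beta')
    from M1.borel_measurable_nn_integral_fst[OF this]
    have "(\<lambda>y. \<integral>\<^sup>+x. G x y * indicator {0..1} x \<partial>?M) \<in> borel_measurable ?M" by simp
    moreover have "(\<integral>\<^sup>+x. G x y * indicator {0..1} x \<partial>?M) = I y" for y
    proof -
      have "(\<integral>\<^sup>+x. G x y * indicator {0..1} x \<partial>?M) = (\<integral>\<^sup>+x. G x y \<partial>restrict_space ?M {0..1})"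
        by (subst nn_integral_restrict_space) (auto simp: hybrid_domain_def Int_absorb1)
      also have "\<dots> = I y"
        unfolding restrict_space_hybrid_unit_interval I_def
        by (subst nn_integral_restrict_space) auto
      finally show ?thesis .
    qed
    ultimately show ?thesis by simp
  qed
  have "(\<integral>\<^sup>+(x, y). G x y \<partial>(?M \<Otimes>\<^sub>M ?M)) = (\<integral>\<^sup>+y. (\<integral>\<^sup>+x. G x y \<partial>?M) \<partial>?M)"
    using nn_integral_snd[OF G] by simp
  also have "\<dots> = (\<integral>\<^sup>+y. I y + (\<Sum>k=2..N+1. G (real k) y) \<partial>?M)"
    using sec' unfolding I_def by (intro nn_integral_cong nn_integral_hybrid) auto
  also have "\<dots> = (\<integral>\<^sup>+y. I y \<partial>?M) + (\<integral>\<^sup>+y. (\<Sum>k=2..N+1. G (real k) y) \<partial>?M)"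
    using I atom by (intro nn_integral_add borel_measurable_sum) auto
  also have "(\<integral>\<^sup>+y. (\<Sum>k=2..N+1. G (real k) y) \<partial>?M) = (\<Sum>k=2..N+1. \<integral>\<^sup>+y. G (real k) y \<partial>?M)"
    using atom by (intro nn_integral_sum) auto
  also have "\<dots> = (\<Sum>k=2..N+1. (\<integral>\<^sup>+x\<in>{0..1}. G (real k) x \<partial>lborel) + (\<Sum>j=2..N+1. G (real k) (real j)))"
    using atom by (intro sum.cong nn_integral_hybrid) auto
  also have "(\<integral>\<^sup>+y. I y \<partial>?M) = (\<integral>\<^sup>+y\<in>{0..1}. I y \<partial>lborel) + (\<Sum>k=2..N+1. I (real k))"
    by (rule nn_integral_hybrid[OF I])
  also have "(\<Sum>k=2..N+1. I (real k)) = (\<Sum>k=2..N+1. \<integral>\<^sup>+x\<in>{0..1}. G (real k) x \<partial>lborel)"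
    unfolding I_def by (simp add: sym[of _ "real _"])
  finally show ?thesis by (simp add: I_def)
qed

section \<open>Finiteness of the energy and the structure of the energy space\<close>

text \<open>Since \<open>k\<close> is at least 2, its distance to [0,1] is at least 1 and the kernel
  is at most 1 there. The squared difference is then bounded by twice the sum of the squares, which
  is integrable on [0,1].\<close>

lemma nn_integral_gagliardo_form_atom_finite:
  assumes w: "w \<in> borel_measurable (hybrid_measure N)" "integrable (hybrid_measure N) (\<lambda>x. (w x)\<^sup>2)"
    and "0 < \<alpha>" "k \<in> {2..N+1}"
  shows "(\<integral>\<^sup>+x\<in>{0..1}. ennreal (gagliardo_form \<alpha> w w (real k) x) \<partial>lborel) < \<infinity>"
proof -
  let ?L = "restrict_space lborel {0..1::real}"
  have "gagliardo_form \<alpha> w w (real k) x \<le> 2 * (w (real k))\<^sup>2 + 2 * (w x)\<^sup>2" if "x \<in> {0..1}" for x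
  proof -
    have "1 \<le> \<bar>real k - x\<bar> powr (1 + 2 * \<alpha>)"
      using that assms by (intro ge_one_powr_ge_zero) auto
    then have "gagliardo_form \<alpha> w w (real k) x \<le> (w (real k) - w x) * (w (real k) - w x)"
      unfolding gagliardo_form_def by (simp add: divide_le_eq mult_le_cancel_left1)
    also have "\<dots> \<le> 2 * (w (real k))\<^sup>2 + 2 * (w x)\<^sup>2"
      using zero_le_power2[of "w (real k) + w x"] by (simp add: power2_eq_square algebra_simps)
    finally show ?thesis .
  qed
  then have "(\<integral>\<^sup>+x. ennreal (gagliardo_form \<alpha> w w (real k) x) \<partial>?L)
      \<le> (\<integral>\<^sup>+x. ennreal (2 * (w (real k))\<^sup>2 + 2 * (w x)\<^sup>2) \<partial>?L)"
    by (intro nn_integral_mono ennreal_leI) auto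
  also have "\<dots> < \<infinity>"
  proof -
    have "integrable (hybrid_measure N) (\<lambda>x. 2 * (w (real k))\<^sup>2 + 2 * (w x)\<^sup>2)"
      using w finite_measure.integrable_const[OF finite_measure_hybrid]
      by (intro Bochner_Integration.integrable_add integrable_mult_right) auto
    then show ?thesis
      using integrableD(2)[of ?L] unfolding integrable_hybrid_iff
      by (simp add: real_integrable_def less_top)
  qed
  finally show ?thesis by (subst (asm) nn_integral_restrict_space) auto
qed

text \<open>Of the blocks of the energy only the one over the unit square, the Gagliardo seminorm,
  can be infinite: the mixed blocks are controlled by the L2 norm and the discrete block is a finite
  sum. The equivalence holds for every \<open>N\<close>.\<close>

lemma hybrid_space_iff:
  assumes "0 < \<alpha>"
  shows "w \<in> hybrid_space \<alpha> \<longleftrightarrow>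
    w \<in> borel_measurable (hybrid_measure N) \<and> integrable (hybrid_measure N) (\<lambda>x. (w x)\<^sup>2) \<and>
    integrable (hybrid_measure N \<Otimes>\<^sub>M hybrid_measure N) (\<lambda>(x, y). gagliardo_form \<alpha> w w x y)"
    (is "_ \<longleftrightarrow> ?meas \<and> ?int \<and> integrable ?P ?F")
proof -
  let ?L = "restrict_space lborel {0..1::real}"
  let ?S = "\<integral>\<^sup>+y\<in>{0..1}. (\<integral>\<^sup>+x\<in>{0..1}. ennreal (gagliardo_form \<alpha> w w x y) \<partial>lborel) \<partial>lborel"
  \<comment> \<open>\<open>restrict\<close> takes the value \<open>undefined\<close> off [0,1], but
    measurability and the integrals below only involve points of [0,1].\<close>
  have "restrict w {0..1} \<in> borel_measurable ?L \<longleftrightarrow> w \<in> borel_measurable ?L"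
    by (intro measurable_cong) auto
  moreover have "integrable ?L (\<lambda>x. (restrict w {0..1} x)\<^sup>2) \<longleftrightarrow> integrable ?L (\<lambda>x. (w x)\<^sup>2)"
    by (intro Bochner_Integration.integrable_cong) auto
  moreover have "gagliardo_seminorm_sq \<alpha> (restrict w {0..1}) = ?S"
    unfolding gagliardo_seminorm_sq_def gagliardo_integrand_eq_form gagliardo_form_def
    by (auto intro!: nn_integral_cong simp: indicator_def)
  ultimately have "w \<in> hybrid_space \<alpha> \<longleftrightarrow> ?meas \<and> ?int \<and> ?S < \<infinity>"
    by (simp add: hybrid_space_def frac_sobolev_def L2_space_def borel_measurable_hybrid_iff
        integrable_hybrid_iff conj_assoc)
  moreover have "?S < \<infinity> \<longleftrightarrow> integrable ?P ?F" if meas: ?meas and int: ?int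
  proof -
    have [measurable]: "?F \<in> borel_measurable ?P"
      using meas by (intro measurable_gagliardo_form)
    have "integrable ?P ?F \<longleftrightarrow> (\<integral>\<^sup>+(x, y). ennreal (gagliardo_form \<alpha> w w x y) \<partial>?P) < \<infinity>"
      by (subst integrable_iff_bounded)
        (simp add: case_prod_beta' gagliardo_form_nonneg)
    also have "\<dots> \<longleftrightarrow> ?S < \<infinity>"
    proof (subst nn_integral_hybrid_pair)
      show "ennreal (gagliardo_form \<alpha> w w x y) = ennreal (gagliardo_form \<alpha> w w y x)" for x y
        by (simp only: gagliardo_form_sym)
      have finite_sum: "(\<Sum>k=2..N+1. h k) < \<infinity>" if "\<And>k. k \<in> {2..N+1} \<Longrightarrow> h k < \<infinity>" for h :: "nat \<Rightarrow> ennreal"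
        using that unfolding infinity_ennreal_def ennreal_sum_less_top[OF finite_atLeastAtMost] by blast
      \<comment> \<open>Here \<open>a\<close> stands for the block over the unit square,
        \<open>b\<close> for the mixed blocks, which occur twice, and \<open>c\<close> for the
        discrete block.\<close>
      have cancel: "a + b + (b + c) < \<infinity> \<longleftrightarrow> a < \<infinity>" if "b < \<infinity>" "c < \<infinity>" for a b c :: ennreal
        using that by simp
      show "?S + (\<Sum>k=2..N+1. \<integral>\<^sup>+x\<in>{0..1}. ennreal (gagliardo_form \<alpha> w w (real k) x) \<partial>lborel)
          + (\<Sum>k=2..N+1. (\<integral>\<^sup>+x\<in>{0..1}. ennreal (gagliardo_form \<alpha> w w (real k) x) \<partial>lborel)
              + (\<Sum>j=2..N+1. ennreal (gagliardo_form \<alpha> w w (real k) (real j)))) < \<infinity>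
        \<longleftrightarrow> ?S < \<infinity>"
        unfolding sum.distrib
        by (intro cancel finite_sum nn_integral_gagliardo_form_atom_finite[OF meas int assms]) auto
    qed (simp add: case_prod_beta')
    finally show ?thesis by simp
  qed
  ultimately show ?thesis by blast
qed

text \<open>Giving each difference the square root of the kernel factors the form into
  \<open>r v\<close> times \<open>r w\<close>, both square-integrable because the diagonal forms of
  \<open>v\<close> and \<open>w\<close> are integrable.\<close>

lemma integrable_gagliardo_form:
  assumes "0 < \<alpha>" and v: "v \<in> hybrid_space \<alpha>" and w: "w \<in> hybrid_space \<alpha>"
  shows "integrable (hybrid_measure N \<Otimes>\<^sub>M hybrid_measure N) (\<lambda>(x, y). gagliardo_form \<alpha> v w x y)"
proof -
  define r where "r u = (\<lambda>(x, y). (u x - u y) / sqrt (\<bar>x - y\<bar> powr (1 + 2 * \<alpha>)))" for u :: "real \<Rightarrow> real"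
  have form: "(\<lambda>(x, y). gagliardo_form \<alpha> u u' x y) = (\<lambda>p. r u p * r u' p)" for u u'
    by (auto simp: r_def gagliardo_form_def fun_eq_iff)
  have r: "r u \<in> borel_measurable (hybrid_measure N \<Otimes>\<^sub>M hybrid_measure N)"
    "integrable (hybrid_measure N \<Otimes>\<^sub>M hybrid_measure N) (\<lambda>p. (r u p)\<^sup>2)" if "u \<in> hybrid_space \<alpha>" for u
  proof -
    have [measurable]: "u \<in> borel_measurable (hybrid_measure N)"
      using that hybrid_space_iff[OF assms(1)] by blast
    show "r u \<in> borel_measurable (hybrid_measure N \<Otimes>\<^sub>M hybrid_measure N)"
      unfolding r_def by measurable
    show "integrable (hybrid_measure N \<Otimes>\<^sub>M hybrid_measure N) (\<lambda>p. (r u p)\<^sup>2)"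
      using that hybrid_space_iff[OF assms(1), of u N] form[of u u] by (simp add: power2_eq_square)
  qed
  show ?thesis unfolding form by (intro integrable_mult_of_squares r v w)
qed

lemma integrable_hybrid_mult:
  assumes "0 < \<alpha>" "v \<in> hybrid_space \<alpha>" "w \<in> hybrid_space \<alpha>"
  shows "integrable (hybrid_measure N) (\<lambda>x. v x * w x)"
  using hybrid_space_iff[OF assms(1), of v N] hybrid_space_iff[OF assms(1), of w N] assms(2,3)
  by (intro integrable_mult_of_squares) simp_all

lemma hybrid_space_add_scaled:
  assumes "0 < \<alpha>" and v: "v \<in> hybrid_space \<alpha>" and w: "w \<in> hybrid_space \<alpha>"
  shows "(\<lambda>x. v x + t * w x) \<in> hybrid_space \<alpha>"
proof -
  \<comment> \<open>Membership in \<open>hybrid_space \<alpha>\<close> can be tested with any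
    \<open>N\<close>. For \<open>N = 0\<close> the index range is empty and the domain is just
    [0,1].\<close>
  let ?M = "hybrid_measure 0"
  have [measurable]: "v \<in> borel_measurable ?M" "w \<in> borel_measurable ?M"
    using v w hybrid_space_iff[OF assms(1)] by blast+
  have "integrable ?M (\<lambda>x. v x * v x + 2 * t * (v x * w x) + t\<^sup>2 * (w x * w x))"
    using integrable_hybrid_mult[OF assms(1)] v w by simp
  then have "integrable ?M (\<lambda>x. (v x + t * w x)\<^sup>2)"
    by (simp add: power2_eq_square algebra_simps)
  moreover have "integrable (?M \<Otimes>\<^sub>M ?M)
      (\<lambda>(x, y). gagliardo_form \<alpha> (\<lambda>x. v x + t * w x) (\<lambda>x. v x + t * w x) x y)"
    unfolding gagliardo_form_add_scaled
    using integrable_gagliardo_form[OF assms(1), of _ _ 0] v w by (simp add: case_prod_beta')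
  ultimately show ?thesis
    using hybrid_space_iff[OF assms(1), of _ 0] by simp
qed

text \<open>Passes from the extended-valued energy to a Bochner integral, where linearity also
  applies to the polarised form, whose sign is not fixed.\<close>

lemma hybrid_energy_eq_integral:
  assumes "0 < \<alpha>" "w \<in> hybrid_space \<alpha>"
  shows "enn2real (hybrid_energy N \<alpha> w) =
    (\<integral>(x, y). gagliardo_form \<alpha> w w x y \<partial>(hybrid_measure N \<Otimes>\<^sub>M hybrid_measure N))"
proof -
  have "(\<lambda>(x, y). gagliardo_form \<alpha> w w x y) \<in> borel_measurable (hybrid_measure N \<Otimes>\<^sub>M hybrid_measure N)"
    using assms hybrid_space_iff[OF assms(1)] by (intro measurable_gagliardo_form) blast+
  then show ?thesis
    by (subst integral_eq_nn_integral)
      (auto simp: hybrid_energy_def gagliardo_integrand_eq_form gagliardo_form_nonneg case_prod_beta')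
qed

section \<open>The functional along a line and its Euler-Lagrange equation\<close>

text \<open>The factors 1/2 in the functional cancel the 2 of each cross term, so the coefficient of
  \<open>t\<close> is exactly the difference of the two sides of the weak equation for
  \<open>v\<close> tested with \<open>w\<close>.\<close>

lemma hybrid_functional_add_scaled:
  assumes "0 < \<alpha>" and f: "f \<in> L2_space (hybrid_measure N)"
    and v: "v \<in> hybrid_space \<alpha>" and w: "w \<in> hybrid_space \<alpha>"
  shows "hybrid_functional N \<alpha> lam f (\<lambda>x. v x + t * w x) = hybrid_functional N \<alpha> lam f v
    + ((\<integral>(x, y). gagliardo_form \<alpha> v w x y \<partial>(hybrid_measure N \<Otimes>\<^sub>M hybrid_measure N))
       + lam * (\<integral>x. v x * w x \<partial>hybrid_measure N) - (\<integral>x. f x * w x \<partial>hybrid_measure N)) * t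
    + (1 / 2 * (\<integral>(x, y). gagliardo_form \<alpha> w w x y \<partial>(hybrid_measure N \<Otimes>\<^sub>M hybrid_measure N))
       + lam / 2 * (\<integral>x. w x * w x \<partial>hybrid_measure N)) * t\<^sup>2"
proof -
  let ?M = "hybrid_measure N"
  let ?P = "?M \<Otimes>\<^sub>M ?M"
  let ?E = "\<lambda>v w. \<integral>(x, y). gagliardo_form \<alpha> v w x y \<partial>?P"
  let ?Q = "\<lambda>v w. \<integral>x. v x * w x \<partial>?M"
  let ?z = "\<lambda>x. v x + t * w x"
  have functional: "hybrid_functional N \<alpha> lam f u = 1 / 2 * ?E u u + lam / 2 * ?Q u u - ?Q f u"
    if "u \<in> hybrid_space \<alpha>" for u
    using hybrid_energy_eq_integral[OF assms(1) that]
    by (simp add: hybrid_functional_def L2_norm_def power2_eq_square)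
  have E: "?E ?z ?z = ?E v v + 2 * t * ?E v w + t\<^sup>2 * ?E w w"
    unfolding gagliardo_form_add_scaled
    using integrable_gagliardo_form[OF assms(1), of _ _ N] v w by (simp add: case_prod_beta')
  have Q: "?Q ?z ?z = ?Q v v + 2 * t * ?Q v w + t\<^sup>2 * ?Q w w"
  proof -
    have "?Q ?z ?z = (\<integral>x. v x * v x + 2 * t * (v x * w x) + t\<^sup>2 * (w x * w x) \<partial>?M)"
      by (simp add: power2_eq_square algebra_simps)
    then show ?thesis using integrable_hybrid_mult[OF assms(1), of _ _ N] v w by simp
  qed
  have Qf: "?Q f ?z = ?Q f v + t * ?Q f w"
  proof -
    have "integrable ?M (\<lambda>x. f x * u x)" if "u \<in> hybrid_space \<alpha>" for u
      using f that hybrid_space_iff[OF assms(1), of u N]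
      by (intro integrable_mult_of_squares) (auto simp: L2_space_def)
    moreover have "?Q f ?z = (\<integral>x. f x * v x + t * (f x * w x) \<partial>?M)"
      by (simp add: algebra_simps)
    ultimately show ?thesis using v w by simp
  qed
  have arith: "1 / 2 * (a + 2 * t * b + t\<^sup>2 * c) + lam / 2 * (a' + 2 * t * b' + t\<^sup>2 * c') - (d + t * e) =
      1 / 2 * a + lam / 2 * a' - d + (b + lam * b' - e) * t + (1 / 2 * c + lam / 2 * c') * t\<^sup>2"
    for a b c a' b' c' d e :: real
    by (simp add: field_simps)
  show ?thesis
    unfolding functional[OF v] functional[OF hybrid_space_add_scaled[OF assms(1) v w]] E Q Qf
    by (rule arith)
qed

theorem theorem4p1:
  fixes N :: nat and \<alpha> lam :: real and f u \<phi> :: "real \<Rightarrow> real"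
  assumes "N \<ge> 2"
    and "0 < \<alpha>" and "\<alpha> < 1"
    and "lam > 0"
    and "f \<in> L2_space (hybrid_measure N)"
    and "is_arg_min (hybrid_functional N \<alpha> lam f) (\<lambda>w. w \<in> hybrid_space \<alpha>) u"
    and "\<phi> \<in> hybrid_space \<alpha>"
  shows "(LINT y:{0..1}|lborel. (LINT x:{0..1}|lborel.
            (u x - u y) * (\<phi> x - \<phi> y) / \<bar>x - y\<bar> powr (1 + 2 * \<alpha>)))
      + 2 * (\<Sum>k=2..N+1. LINT x:{0..1}|lborel.
            (u (real k) - u x) * (\<phi> (real k) - \<phi> x) / \<bar>real k - x\<bar> powr (1 + 2 * \<alpha>))
      + (\<Sum>(i, j) | i \<in> {2..N+1} \<and> j \<in> {2..N+1} \<and> i \<noteq> j.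
            (u (real i) - u (real j)) * (\<phi> (real i) - \<phi> (real j))
              / \<bar>real i - real j\<bar> powr (1 + 2 * \<alpha>))
      + lam * (\<integral>x. u x * \<phi> x \<partial>hybrid_measure N)
    = (\<integral>x. f x * \<phi> x \<partial>hybrid_measure N)"
proof -
  let ?M = "hybrid_measure N"
  let ?E = "\<lambda>v w. \<integral>(x, y). gagliardo_form \<alpha> v w x y \<partial>(?M \<Otimes>\<^sub>M ?M)"
  let ?g = "gagliardo_form \<alpha> u \<phi>"
  have u: "u \<in> hybrid_space \<alpha>"
    and min: "hybrid_functional N \<alpha> lam f u \<le> hybrid_functional N \<alpha> lam f w" if "w \<in> hybrid_space \<alpha>" for w
    using assms(6) that by (auto simp: is_arg_min_linorder)
  \<comment> \<open>The premise introduced by \<open>if\<close> also guards the membership of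
    \<open>u\<close>; \<open>\<phi>\<close>, a member of the space, discharges it.\<close>
  note u = u[OF assms(7)]
  have "?E u \<phi> + lam * (\<integral>x. u x * \<phi> x \<partial>?M) - (\<integral>x. f x * \<phi> x \<partial>?M) = 0"
  proof (rule quadratic_min_at_0_imp_linear_coeff_0)
    fix t
    show "0 \<le> (?E u \<phi> + lam * (\<integral>x. u x * \<phi> x \<partial>?M) - (\<integral>x. f x * \<phi> x \<partial>?M)) * t
        + (1 / 2 * ?E \<phi> \<phi> + lam / 2 * (\<integral>x. \<phi> x * \<phi> x \<partial>?M)) * t\<^sup>2"
      using min[OF hybrid_space_add_scaled[OF assms(2) u assms(7)], of t]
      unfolding hybrid_functional_add_scaled[OF assms(2,5) u assms(7)] by linarith
  qed
  moreover have "?E u \<phi> = (LINT y:{0..1}|lborel. (LINT x:{0..1}|lborel. ?g x y))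
      + 2 * (\<Sum>k=2..N+1. LINT x:{0..1}|lborel. ?g (real k) x)
      + (\<Sum>k=2..N+1. \<Sum>j=2..N+1. ?g (real k) (real j))"
    using integrable_gagliardo_form[OF assms(2) u assms(7)] gagliardo_form_sym
    by (rule integral_hybrid_pair)
  \<comment> \<open>Terms with equal indices have a vanishing numerator, so the full double sum
    reduces to the off-diagonal one.\<close>
  moreover have "(\<Sum>k=2..N+1. \<Sum>j=2..N+1. ?g (real k) (real j)) =
      (\<Sum>(i, j) | i \<in> {2..N+1} \<and> j \<in> {2..N+1} \<and> i \<noteq> j. ?g (real i) (real j))"
    unfolding sum.cartesian_product
    by (rule sum.mono_neutral_right) (auto simp: gagliardo_form_def)
  ultimately show ?thesis by (simp add: gagliardo_form_def)
qed

end
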